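(* Let $g,g'\in\Sigma$. If $g'\notin[g]$, then $\mathfrak{I}_{[g]}\star\mathfrak{I}_{[g']}=\mathbf{0}$.
   Context: $\mathbb{N}$ is the set of non-negative integers. For subsets $X,Y$ of an algebra with product $\star$, $X\star Y$ denotes the submodule spanned by all $x\star y$, $x\in X$, $y\in Y$. Setting. Let $\mathcal{R}$ be a commutative ring, $I$ an arbitrary index set, and $\mathcal{M}_I(\mathcal{R})$ the $\mathcal{R}$-algebra of $I\times I$ matrices over $\mathcal{R}$ with only finitely many non-zero entries, with the usual product (juxtaposition). Let $\psi,\phi$ be two commuting $\mathcal{R}$-algebra automorphisms of it and put $x\star y:=\psi(x)\phi(y)$. Let $(G,+)$ be an abelian group with neutral element $\mathbf{0}$ and let $\alpha,\beta$ be two commuting automorphisms of $G$. Suppose $\mathcal{M}_I(\mathcal{R})=\bigoplus_{g\in G}\mathcal{M}_I(\mathcal{R})_g$ is a direct sum of $\mathcal{R}$-submodules such that, for all $g,g'\in G$, $\psi(\mathcal{M}_I(\mathcal{R})_g)\subseteq\mathcal{M}_I(\mathcal{R})_{\alpha(g)}$, $\phi(\mathcal{M}_I(\mathcal{R})_g)\subseteq\mathcal{M}_I(\mathcal{R})_{\beta(g)}$ and $\mathcal{M}_I(\mathcal{R})_g\star\mathcal{M}_I(\mathcal{R})_{g'}\subseteq\mathcal{M}_I(\mathcal{R})_{\alpha(g)+\beta(g')}$. The support is $\Sigma:=\{g\in G\setminus\{\mathbf{0}\}\mid \mathcal{M}_I(\mathcal{R})_g\neq 0\}$. It is assumed symmetric: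 $g\in\Sigma$ implies $-g\in\Sigma$. Connections. For $g,g'\in\Sigma$, a connection from $g$ to $g'$ is a finite sequence $g_1,\dots,g_k$ of elements of $\Sigma$ ($k\ge 1$) such that: if $k=1$, then $g_1\in\{\alpha^i\circ\beta^j(g)\mid i,j\in\mathbb{N}\}\cap\{\pm\alpha^m\circ\beta^n(g')\mid m,n\in\mathbb{N}\}$; if $k\ge 2$, then (1) $g_1\in\{\alpha^i\circ\beta^j(g)\mid i,j\in\mathbb{N}\}$, (2) for every $2\le l\le k-1$ the element $\alpha^{l-1}(g_1)+\sum_{t=2}^{l}\alpha^{l-t}\circ\beta(g_t)$ belongs to $\Sigma$, and (3) $\alpha^{k-1}(g_1)+\sum_{t=2}^{k}\alpha^{k-t}\circ\beta(g_t)\in\{\pm\alpha^m\circ\beta^n(g')\mid m,n\in\mathbb{N}\}$. Write $g\sim g'$ if a connection from $g$ to $g'$ exists; $\sim$ is an equivalence relation on $\Sigma$ and $[g]$ denotes the class of $g$. For $g\in\Sigma$ put $\mathfrak{I}_{\mathbf{0},[g]}:=\operatorname{Span}_{\mathcal{R}}\{\mathcal{M}_I(\mathcal{R})_{\beta(h)}\star\mathcal{M}_I(\mathcal{R})_{-\alpha(h)}\mid h\in[g]\}\subseteq\mathcal{M}_I(\mathcal{R})_{\mathbf{0}}$, $V_{[g]}:=\bigoplus_{h\in[g]}\mathcal{M}_I(\mathcal{R})_{h}$ and $\mathfrak{I}_{[g]}:=\mathfrak{I}_{\mathbf{0},[g]}\oplus V_{[g]}$. *)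

theory Defs
  imports Main "HOL.Modules" "HOL-Library.Function_Algebras" "HOL-Library.Groups_Big_Fun"
begin

section \<open>The algebra of finitely supported matrices\<close>

text \<open>Matrices are functions; zero, sum and negation are the pointwise ones of
  \<^theory>\<open>HOL-Library.Function_Algebras\<close>. The pointwise product which that theory also
  provides plays no role; the matrix product is \<open>mat_mult\<close>.\<close>

type_synonym ('i, 'r) imat = "'i \<Rightarrow> 'i \<Rightarrow> 'r"

text \<open>The index set is a set and not a type, so that it may be empty.\<close>

definition fin_mats :: "'i set \<Rightarrow> ('i, 'r::comm_ring_1) imat set" where
  "fin_mats I = {A. {(i, j). A i j \<noteq> 0} \<subseteq> I \<times> I \<and> finite {(i, j). A i j \<noteq> 0}}"

definition mat_scale :: "'r::comm_ring_1 \<Rightarrow> ('i, 'r) imat \<Rightarrow> ('i, 'r) imat" where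
  "mat_scale c A = (\<lambda>i j. c * A i j)"

definition mat_mult :: "('i, 'r::comm_ring_1) imat \<Rightarrow> ('i, 'r) imat \<Rightarrow> ('i, 'r) imat" where
  "mat_mult A B = (\<lambda>i j. \<Sum>k. A i k * B k j)"

text \<open>\<open>mats.subspace\<close> and \<open>mats.span\<close> are the notions of submodule and of the submodule
  spanned by a set.\<close>

global_interpretation mats: module "mat_scale :: 'r::comm_ring_1 \<Rightarrow> ('i, 'r) imat \<Rightarrow> ('i, 'r) imat"
  by unfold_locales (auto simp: mat_scale_def fun_eq_iff algebra_simps)

definition algebra_automorphism ::
    "'i set \<Rightarrow> (('i, 'r::comm_ring_1) imat \<Rightarrow> ('i, 'r) imat) \<Rightarrow> bool" where
  "algebra_automorphism I f \<longleftrightarrow>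
     bij_betw f (fin_mats I) (fin_mats I) \<and>
     (\<forall>A\<in>fin_mats I. \<forall>B\<in>fin_mats I. f (A + B) = f A + f B) \<and>
     (\<forall>c. \<forall>A\<in>fin_mats I. f (mat_scale c A) = mat_scale c (f A)) \<and>
     (\<forall>A\<in>fin_mats I. \<forall>B\<in>fin_mats I. f (mat_mult A B) = mat_mult (f A) (f B))"

definition star ::
    "(('i, 'r::comm_ring_1) imat \<Rightarrow> ('i, 'r) imat) \<Rightarrow> (('i, 'r) imat \<Rightarrow> ('i, 'r) imat) \<Rightarrow>
     ('i, 'r) imat \<Rightarrow> ('i, 'r) imat \<Rightarrow> ('i, 'r) imat" where
  "star \<psi> \<phi> A B = mat_mult (\<psi> A) (\<phi> B)"

definition star_set ::
    "(('i, 'r::comm_ring_1) imat \<Rightarrow> ('i, 'r) imat) \<Rightarrow> (('i, 'r) imat \<Rightarrow> ('i, 'r) imat) \<Rightarrow>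
     ('i, 'r) imat set \<Rightarrow> ('i, 'r) imat set \<Rightarrow> ('i, 'r) imat set" where
  "star_set \<psi> \<phi> X Y = mats.span {star \<psi> \<phi> x y | x y. x \<in> X \<and> y \<in> Y}"


section \<open>Gradings\<close>

definition group_automorphism :: "('g::ab_group_add \<Rightarrow> 'g) \<Rightarrow> bool" where
  "group_automorphism \<alpha> \<longleftrightarrow> additive \<alpha> \<and> bij \<alpha>"

definition direct_sum_decomposition ::
    "'i set \<Rightarrow> ('g \<Rightarrow> ('i, 'r::comm_ring_1) imat set) \<Rightarrow> bool" where
  "direct_sum_decomposition I M \<longleftrightarrow>
     (\<forall>g. mats.subspace (M g) \<and> M g \<subseteq> fin_mats I) \<and>
     (\<forall>A\<in>fin_mats I. \<exists>!x. (\<forall>g. x g \<in> M g) \<and> finite {g. x g \<noteq> 0} \<and>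
        A = (\<Sum>g | x g \<noteq> 0. x g))"

definition supp :: "('g::ab_group_add \<Rightarrow> ('i, 'r::comm_ring_1) imat set) \<Rightarrow> 'g set" where
  "supp M = {g. g \<noteq> 0 \<and> M g \<noteq> {0}}"


section \<open>Connections\<close>

definition orbit_set :: "('g \<Rightarrow> 'g) \<Rightarrow> ('g \<Rightarrow> 'g) \<Rightarrow> 'g::ab_group_add \<Rightarrow> 'g set" where
  "orbit_set \<alpha> \<beta> g = {((\<alpha> ^^ i) \<circ> (\<beta> ^^ j)) g | i j. True}"

definition signed_orbit_set :: "('g \<Rightarrow> 'g) \<Rightarrow> ('g \<Rightarrow> 'g) \<Rightarrow> 'g::ab_group_add \<Rightarrow> 'g set" where
  "signed_orbit_set \<alpha> \<beta> g = orbit_set \<alpha> \<beta> g \<union> uminus ` orbit_set \<alpha> \<beta> g"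

text \<open>A sequence \<open>g\<^sub>1, \<dots>, g\<^sub>k\<close> is encoded by a function \<open>s\<close> with \<open>s t = g\<^sub>t\<close>;
  only its values at \<open>1, \<dots>, k\<close> matter.\<close>

definition conn_sum :: "('g \<Rightarrow> 'g) \<Rightarrow> ('g \<Rightarrow> 'g) \<Rightarrow> (nat \<Rightarrow> 'g::ab_group_add) \<Rightarrow> nat \<Rightarrow> 'g" where
  "conn_sum \<alpha> \<beta> s l = (\<alpha> ^^ (l - 1)) (s 1) + (\<Sum>t = 2..l. ((\<alpha> ^^ (l - t)) \<circ> \<beta>) (s t))"

definition is_connection ::
    "('g \<Rightarrow> 'g) \<Rightarrow> ('g \<Rightarrow> 'g) \<Rightarrow> 'g set \<Rightarrow> 'g \<Rightarrow> 'g \<Rightarrow> nat \<Rightarrow> (nat \<Rightarrow> 'g::ab_group_add) \<Rightarrow> bool" where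
  "is_connection \<alpha> \<beta> \<Sigma> g g' k s \<longleftrightarrow>
     k \<ge> 1 \<and> (\<forall>t\<in>{1..k}. s t \<in> \<Sigma>) \<and>
     (if k = 1 then s 1 \<in> orbit_set \<alpha> \<beta> g \<inter> signed_orbit_set \<alpha> \<beta> g'
      else s 1 \<in> orbit_set \<alpha> \<beta> g \<and>
           (\<forall>l\<in>{2..k - 1}. conn_sum \<alpha> \<beta> s l \<in> \<Sigma>) \<and>
           conn_sum \<alpha> \<beta> s k \<in> signed_orbit_set \<alpha> \<beta> g')"

definition conn_rel :: "('g \<Rightarrow> 'g) \<Rightarrow> ('g \<Rightarrow> 'g) \<Rightarrow> 'g set \<Rightarrow> ('g::ab_group_add \<times> 'g) set" where
  "conn_rel \<alpha> \<beta> \<Sigma> = {(g, g'). g \<in> \<Sigma> \<and> g' \<in> \<Sigma> \<and> (\<exists>k s. is_connection \<alpha> \<beta> \<Sigma> g g' k s)}"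

abbreviation conn_class :: "('g \<Rightarrow> 'g) \<Rightarrow> ('g \<Rightarrow> 'g) \<Rightarrow> 'g set \<Rightarrow> 'g::ab_group_add \<Rightarrow> 'g set" where
  "conn_class \<alpha> \<beta> \<Sigma> g \<equiv> conn_rel \<alpha> \<beta> \<Sigma> `` {g}"


section \<open>The submodules attached to a set of degrees\<close>

text \<open>In the following three definitions \<open>C\<close> is meant to be a connection class.\<close>

definition ideal_zero ::
    "(('i, 'r::comm_ring_1) imat \<Rightarrow> ('i, 'r) imat) \<Rightarrow> (('i, 'r) imat \<Rightarrow> ('i, 'r) imat) \<Rightarrow>
     ('g::ab_group_add \<Rightarrow> 'g) \<Rightarrow> ('g \<Rightarrow> 'g) \<Rightarrow> ('g \<Rightarrow> ('i, 'r) imat set) \<Rightarrow> 'g set \<Rightarrow>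
     ('i, 'r) imat set" where
  "ideal_zero \<psi> \<phi> \<alpha> \<beta> M C = mats.span (\<Union>h\<in>C. star_set \<psi> \<phi> (M (\<beta> h)) (M (- \<alpha> h)))"

text \<open>For a direct sum decomposition \<open>M\<close> the sum of the \<open>M h\<close> with \<open>h \<in> C\<close> is direct, so the
  internal direct sum is the submodule they span. Likewise the sum in \<open>ideal_sum\<close> is direct,
  because the first summand lies in degree \<open>0\<close> and \<open>0 \<notin> C\<close>.\<close>

definition class_sum ::
    "('g \<Rightarrow> ('i, 'r::comm_ring_1) imat set) \<Rightarrow> 'g set \<Rightarrow> ('i, 'r) imat set" where
  "class_sum M C = mats.span (\<Union>h\<in>C. M h)"

definition ideal_sum ::
    "(('i, 'r::comm_ring_1) imat \<Rightarrow> ('i, 'r) imat) \<Rightarrow> (('i, 'r) imat \<Rightarrow> ('i, 'r) imat) \<Rightarrow>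
     ('g::ab_group_add \<Rightarrow> 'g) \<Rightarrow> ('g \<Rightarrow> 'g) \<Rightarrow> ('g \<Rightarrow> ('i, 'r) imat set) \<Rightarrow> 'g set \<Rightarrow>
     ('i, 'r) imat set" where
  "ideal_sum \<psi> \<phi> \<alpha> \<beta> M C = {a + b | a b. a \<in> ideal_zero \<psi> \<phi> \<alpha> \<beta> M C \<and> b \<in> class_sum M C}"

end

theory Submission
  imports Defs
begin

text \<open>
  The twisting by \<open>\<psi>\<close> and \<open>\<phi>\<close> can be undone, so that the theorem becomes a statement about the
  ordinary associative matrix product. If \<open>x \<in> M a\<close> and \<open>y \<in> M b\<close>, then
  \<open>\<psi> (\<phi> (x y)) = \<phi> x \<star> \<psi> y\<close> lies in degree \<open>\<alpha> (\<beta> (a + b))\<close>. Hence a non-zero product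
  \<open>x y\<close> forces \<open>\<alpha> (\<beta> (a + b))\<close> to be \<open>0\<close> or in the support, and in both cases \<open>a\<close> and \<open>b\<close> are
  connected (\<open>linked_if_sum_in_support\<close>). So homogeneous matrices with degrees in two
  different connection classes multiply to zero.

  Let \<open>D\<close> be the union of the \<open>M h\<close> with \<open>h\<close> in a class. A class is stable under \<open>\<alpha>\<close>, \<open>\<beta>\<close> and
  negation, hence \<open>\<psi>\<close> and \<open>\<phi>\<close> map \<open>D\<close> into itself, and the ideal of the class lies in the span
  of \<open>D\<close> and of the products of two elements of \<open>D\<close>; this span is again stable under \<open>\<psi>\<close> and
  \<open>\<phi>\<close>. By associativity, two such spans annihilate each other as soon as their sets \<open>D\<close> do
  (\<open>with_products_annihilate\<close>).

  That two different classes are disjoint and that no connection leads from one to the other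
  rests on \<open>\<sim>\<close> being symmetric and transitive. For this a connection is read as a path with steps
  \<open>x \<mapsto> \<alpha> x + \<beta> s\<close> inside the support, between points of the orbits of its two ends under the
  commutative monoid generated by \<open>\<alpha>\<close>, \<open>\<beta>\<close> and negation (\<open>conn_rel_iff_linked\<close>). This monoid acts
  on paths, which gives transitivity, and a step can be run backwards up to
  this action, which gives symmetry.
\<close>

section \<open>Products of finitely supported matrices\<close>

lemma fin_mats_subspace:
  "mats.subspace (fin_mats I :: ('i, 'r::comm_ring_1) imat set)"
proof (rule mats.subspaceI)
  show "(0 :: ('i, 'r) imat) \<in> fin_mats I" by (simp add: fin_mats_def)
next
  fix A B :: "('i, 'r) imat" assume "A \<in> fin_mats I" "B \<in> fin_mats I"
  moreover have "{(i, j). (A + B) i j \<noteq> 0} \<subseteq> {(i, j). A i j \<noteq> 0} \<union> {(i, j). B i j \<noteq> 0}"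
    by auto
  ultimately show "A + B \<in> fin_mats I"
    unfolding fin_mats_def by (auto intro: finite_subset)
next
  fix c and A :: "('i, 'r) imat" assume "A \<in> fin_mats I"
  moreover have "{(i, j). mat_scale c A i j \<noteq> 0} \<subseteq> {(i, j). A i j \<noteq> 0}"
    by (auto simp: mat_scale_def)
  ultimately show "mat_scale c A \<in> fin_mats I"
    unfolding fin_mats_def by (auto intro: finite_subset)
qed

text \<open>One finite index set for rows and columns turns products into finite sums over a common range;
  the sum that defines \<open>mat_mult\<close> has value \<open>0\<close> when infinitely many of its terms are non-zero, so
  bilinearity and associativity depend on finite supports.\<close>

lemma fin_mats_index_set:
  assumes "A \<in> fin_mats I"
  shows "\<exists>K. finite K \<and> K \<subseteq> I \<and> (\<forall>i j. i \<notin> K \<or> j \<notin> K \<longrightarrow> A i j = 0)"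
proof (intro exI conjI allI impI)
  let ?S = "{(i, j). A i j \<noteq> 0}"
  have S: "finite ?S" "?S \<subseteq> I \<times> I" using assms by (auto simp: fin_mats_def)
  show "finite (fst ` ?S \<union> snd ` ?S)" using S(1) by blast
  show "fst ` ?S \<union> snd ` ?S \<subseteq> I" using S(2) by auto
  show "A i j = 0" if "i \<notin> fst ` ?S \<union> snd ` ?S \<or> j \<notin> fst ` ?S \<union> snd ` ?S" for i j
    using that by (force simp: image_iff)
qed

lemma mat_mult_as_finite_sum:
  fixes A B :: "('i, 'r::comm_ring_1) imat"
  assumes "finite K" "\<And>i k. k \<notin> K \<Longrightarrow> A i k = 0 \<or> B k j = 0"
  shows "mat_mult A B i j = (\<Sum>k\<in>K. A i k * B k j)"
  unfolding mat_mult_def using assms by (intro Sum_any.expand_superset) force+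

lemma mat_mult_fin_mats:
  assumes "A \<in> fin_mats I" "B \<in> fin_mats I"
  shows "mat_mult A B \<in> fin_mats I"
proof -
  obtain K where K: "finite K" "K \<subseteq> I" "\<forall>i j. i \<notin> K \<or> j \<notin> K \<longrightarrow> A i j = 0"
    using fin_mats_index_set[OF assms(1)] by blast
  obtain L where L: "finite L" "L \<subseteq> I" "\<forall>i j. i \<notin> L \<or> j \<notin> L \<longrightarrow> B i j = 0"
    using fin_mats_index_set[OF assms(2)] by blast
  have "mat_mult A B i j = 0" if "i \<notin> K \<or> j \<notin> L" for i j
    using that K(3) L(3) by (auto simp: mat_mult_def)
  then have sub: "{(i, j). mat_mult A B i j \<noteq> 0} \<subseteq> K \<times> L" by blast
  have "K \<times> L \<subseteq> I \<times> I" "finite (K \<times> L)" using K(1,2) L(1,2) by auto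
  then have "{(i, j). mat_mult A B i j \<noteq> 0} \<subseteq> I \<times> I" "finite {(i, j). mat_mult A B i j \<noteq> 0}"
    using sub by (blast, metis finite_subset)
  then show ?thesis by (simp add: fin_mats_def)
qed

lemma mat_mult_assoc:
  assumes "A \<in> fin_mats I" "B \<in> fin_mats I" "C \<in> fin_mats I"
  shows "mat_mult (mat_mult A B) C = mat_mult A (mat_mult B C)"
proof (intro ext)
  fix i j
  obtain K where K: "finite K" "K \<subseteq> I" "\<forall>i j. i \<notin> K \<or> j \<notin> K \<longrightarrow> A i j = 0"
    using fin_mats_index_set[OF assms(1)] by blast
  obtain L where L: "finite L" "L \<subseteq> I" "\<forall>i j. i \<notin> L \<or> j \<notin> L \<longrightarrow> C i j = 0"
    using fin_mats_index_set[OF assms(3)] by blast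
  have AB: "mat_mult A B i l = (\<Sum>k\<in>K. A i k * B k l)" for l
    by (rule mat_mult_as_finite_sum) (use K in auto)
  have BC: "mat_mult B C k j = (\<Sum>l\<in>L. B k l * C l j)" for k
    by (rule mat_mult_as_finite_sum) (use L in auto)
  have "mat_mult (mat_mult A B) C i j = (\<Sum>l\<in>L. mat_mult A B i l * C l j)"
    by (rule mat_mult_as_finite_sum) (use L in auto)
  also have "\<dots> = (\<Sum>k\<in>K. A i k * mat_mult B C k j)"
    unfolding AB BC sum_distrib_left sum_distrib_right mult.assoc by (rule sum.swap)
  also have "\<dots> = mat_mult A (mat_mult B C) i j"
    by (rule mat_mult_as_finite_sum[symmetric]) (use K in auto)
  finally show "mat_mult (mat_mult A B) C i j = mat_mult A (mat_mult B C) i j" .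
qed

lemma mat_mult_zero [simp]: "mat_mult 0 B = 0" "mat_mult A 0 = 0"
  by (simp_all add: mat_mult_def fun_eq_iff)

lemma mat_mult_scale:
  assumes "A \<in> fin_mats I"
  shows "mat_mult (mat_scale c A) B = mat_scale c (mat_mult A B)"
    and "mat_mult A (mat_scale c B) = mat_scale c (mat_mult A B)"
proof -
  obtain K where K: "finite K" "K \<subseteq> I" "\<forall>i j. i \<notin> K \<or> j \<notin> K \<longrightarrow> A i j = 0"
    using fin_mats_index_set[OF assms(1)] by blast
  have "mat_mult X Y i j = (\<Sum>k\<in>K. X i k * Y k j)"
    if "X = A \<or> X = mat_scale c A" for X Y i j
    by (rule mat_mult_as_finite_sum) (use K that in \<open>auto simp: mat_scale_def\<close>)
  then show "mat_mult (mat_scale c A) B = mat_scale c (mat_mult A B)"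
    and "mat_mult A (mat_scale c B) = mat_scale c (mat_mult A B)"
    by (auto simp: fun_eq_iff mat_scale_def sum_distrib_left mult.left_commute mult.assoc)
qed

lemma mat_mult_add_left:
  assumes "A \<in> fin_mats I" "B \<in> fin_mats I"
  shows "mat_mult (A + B) C = mat_mult A C + mat_mult B C"
proof -
  obtain K where K: "finite K" "K \<subseteq> I" "\<forall>i j. i \<notin> K \<or> j \<notin> K \<longrightarrow> A i j = 0"
    using fin_mats_index_set[OF assms(1)] by blast
  obtain L where L: "finite L" "L \<subseteq> I" "\<forall>i j. i \<notin> L \<or> j \<notin> L \<longrightarrow> B i j = 0"
    using fin_mats_index_set[OF assms(2)] by blast
  have "mat_mult X C i j = (\<Sum>k\<in>K \<union> L. X i k * C k j)"
    if "X = A \<or> X = B \<or> X = A + B" for X i j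
    by (rule mat_mult_as_finite_sum) (use K L that in auto)
  then show ?thesis
    by (auto simp: fun_eq_iff sum.distrib distrib_right)
qed

lemma mat_mult_add_right:
  assumes "A \<in> fin_mats I"
  shows "mat_mult A (B + C) = mat_mult A B + mat_mult A C"
proof -
  obtain K where K: "finite K" "K \<subseteq> I" "\<forall>i j. i \<notin> K \<or> j \<notin> K \<longrightarrow> A i j = 0"
    using fin_mats_index_set[OF assms(1)] by blast
  have "mat_mult A X i j = (\<Sum>k\<in>K. A i k * X k j)" for X i j
    by (rule mat_mult_as_finite_sum) (use K in auto)
  then show ?thesis
    by (auto simp: fun_eq_iff sum.distrib distrib_left)
qed

lemma mat_mult_span_zero:
  assumes "X \<subseteq> fin_mats I" "Y \<subseteq> fin_mats I"
    and "\<And>x y. x \<in> X \<Longrightarrow> y \<in> Y \<Longrightarrow> mat_mult x y = 0"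
    and "a \<in> mats.span X" "b \<in> mats.span Y"
  shows "mat_mult a b = 0"
proof -
  note sub = mats.subspace_0 mats.subspace_add mats.subspace_scale
  have left: "a \<in> fin_mats I \<and> mat_mult a y = 0" if "y \<in> Y" for y
    using assms(4)
  proof (induction rule: mats.span_induct)
    case base
    show "mats.subspace {a. a \<in> fin_mats I \<and> mat_mult a y = 0}"
      by (rule mats.subspaceI)
        (auto simp: sub[OF fin_mats_subspace] mat_mult_add_left mat_mult_scale)
  qed (use assms that in auto)
  have a: "a \<in> fin_mats I"
    using assms(1,4) mats.span_minimal[OF _ fin_mats_subspace] by blast
  show ?thesis
    using assms(5)
  proof (induction rule: mats.span_induct)
    case base
    show "mats.subspace {b. mat_mult a b = 0}"
      by (rule mats.subspaceI) (auto simp: mat_mult_add_right[OF a] mat_mult_scale[OF a])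
  qed (use left in auto)
qed

text \<open>The ideal of a class is spanned by homogeneous matrices and by certain products of two of them.
  Admitting all products of two elements gives a set that is stable under every multiplicative map
  preserving \<open>D\<close> and still annihilates what \<open>D\<close> annihilates.\<close>

definition with_products :: "('i, 'r::comm_ring_1) imat set \<Rightarrow> ('i, 'r) imat set" where
  "with_products D = D \<union> {mat_mult x y | x y. x \<in> D \<and> y \<in> D}"

lemma with_products_fin_mats:
  "D \<subseteq> fin_mats I \<Longrightarrow> with_products D \<subseteq> fin_mats I"
  by (auto simp: with_products_def intro: mat_mult_fin_mats)

text \<open>In \<open>(d d') (e e')\<close> the inner factor \<open>d' e\<close> is zero; the other products of generators are similar.\<close>

lemma with_products_annihilate:
  assumes D: "D \<subseteq> fin_mats I" and E: "E \<subseteq> fin_mats I"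
    and zero: "\<And>x y. x \<in> D \<Longrightarrow> y \<in> E \<Longrightarrow> mat_mult x y = 0"
    and "a \<in> mats.span (with_products D)" "b \<in> mats.span (with_products E)"
  shows "mat_mult a b = 0"
proof (rule mat_mult_span_zero[OF with_products_fin_mats[OF D] with_products_fin_mats[OF E] _ assms(4,5)])
  fix x y assume x: "x \<in> with_products D" and y: "y \<in> with_products E"
  have right: "mat_mult d y = 0" if d: "d \<in> D" for d
  proof -
    have "mat_mult d (mat_mult e e') = 0" if "e \<in> E" "e' \<in> E" for e e'
    proof -
      have "mat_mult d (mat_mult e e') = mat_mult (mat_mult d e) e'"
        by (metis mat_mult_assoc D E subsetD d that)
      then show ?thesis by (simp add: zero d that)
    qed
    then show ?thesis using y by (auto simp: with_products_def zero d)
  qed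
  have "mat_mult (mat_mult d d') y = 0" if "d \<in> D" "d' \<in> D" for d d'
  proof -
    have "mat_mult (mat_mult d d') y = mat_mult d (mat_mult d' y)"
      by (metis mat_mult_assoc D with_products_fin_mats[OF E] y subsetD that)
    then show ?thesis by (simp add: right that)
  qed
  then show "mat_mult x y = 0" using x by (auto simp: with_products_def right)
qed

lemma algebra_automorphism_zero:
  assumes "algebra_automorphism I f"
  shows "f 0 = 0"
proof -
  have "(0 :: ('a, 'b) imat) \<in> fin_mats I"
    by (rule mats.subspace_0[OF fin_mats_subspace])
  then have "f (0 + 0) = f 0 + f 0"
    using assms unfolding algebra_automorphism_def by blast
  then show ?thesis by simp
qed

lemma algebra_automorphism_nonzero:
  assumes "algebra_automorphism I f" "x \<in> fin_mats I" "x \<noteq> 0"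
  shows "f x \<noteq> 0"
proof -
  have "inj_on f (fin_mats I)"
    using assms(1) by (auto simp: algebra_automorphism_def bij_betw_def)
  then show ?thesis
    using assms mats.subspace_0[OF fin_mats_subspace] algebra_automorphism_zero
    by (metis inj_onD)
qed

lemma algebra_automorphism_span_with_products:
  assumes f: "algebra_automorphism I f" and D: "D \<subseteq> fin_mats I" and "f ` D \<subseteq> D"
    and "x \<in> mats.span (with_products D)"
  shows "f x \<in> mats.span (with_products D)"
proof -
  let ?P = "{x \<in> fin_mats I. f x \<in> mats.span (with_products D)}"
  have "mats.subspace ?P"
    using f mats.subspace_0[OF fin_mats_subspace] mats.subspace_add[OF fin_mats_subspace]
      mats.subspace_scale[OF fin_mats_subspace]
    by (intro mats.subspaceI)
      (auto simp: algebra_automorphism_def algebra_automorphism_zero[OF f]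
        intro: mats.span_zero mats.span_add mats.span_scale)
  moreover have "with_products D \<subseteq> ?P"
  proof
    fix x assume x: "x \<in> with_products D"
    have "f (mat_mult d e) = mat_mult (f d) (f e)" if "d \<in> D" "e \<in> D" for d e
      using f subsetD[OF D that(1)] subsetD[OF D that(2)]
      unfolding algebra_automorphism_def by blast
    then have "f x \<in> with_products D"
      using x assms(3) unfolding with_products_def by blast
    then show "x \<in> ?P"
      using x with_products_fin_mats[OF D] by (auto intro: mats.span_base)
  qed
  ultimately show ?thesis
    using mats.span_minimal assms(4) by blast
qed

section \<open>Connections as paths\<close>

text \<open>Here \<open>\<Sigma>\<close> stands for the support of a grading. Forward stability is what the paths below
  require: they are reversed by cancellation and not by inverting \<open>\<alpha>\<close> or \<open>\<beta>\<close>.\<close>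

locale degree_dynamics =
  fixes \<alpha> \<beta> :: "'g::ab_group_add \<Rightarrow> 'g" and \<Sigma> :: "'g set"
  assumes add_alpha: "additive \<alpha>" and add_beta: "additive \<beta>"
    and commute: "\<alpha> (\<beta> x) = \<beta> (\<alpha> x)"
    and alpha_closed: "x \<in> \<Sigma> \<Longrightarrow> \<alpha> x \<in> \<Sigma>"
    and beta_closed: "x \<in> \<Sigma> \<Longrightarrow> \<beta> x \<in> \<Sigma>"
    and minus_closed: "x \<in> \<Sigma> \<Longrightarrow> - x \<in> \<Sigma>"
begin

lemmas hom_simps = additive.add[OF add_alpha] additive.add[OF add_beta]
  additive.minus[OF add_alpha] additive.minus[OF add_beta]

text \<open>The monoid generated by \<open>\<alpha>\<close>, \<open>\<beta>\<close> and negation. Its orbits are the signed orbits that occur in the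
  definition of connections, but an inductive definition avoids exponents and signs.\<close>

inductive_set twists :: "('g \<Rightarrow> 'g) set" where
  id: "id \<in> twists"
| alpha: "f \<in> twists \<Longrightarrow> \<alpha> \<circ> f \<in> twists"
| beta: "f \<in> twists \<Longrightarrow> \<beta> \<circ> f \<in> twists"
| minus: "f \<in> twists \<Longrightarrow> uminus \<circ> f \<in> twists"

lemma twist_closed: "f \<in> twists \<Longrightarrow> x \<in> \<Sigma> \<Longrightarrow> f x \<in> \<Sigma>"
  by (induction rule: twists.induct) (auto intro: alpha_closed beta_closed minus_closed)

lemma twist_comp: "f \<in> twists \<Longrightarrow> h \<in> twists \<Longrightarrow> f \<circ> h \<in> twists"
  by (induction rule: twists.induct) (auto simp: comp_assoc intro: twists.intros)

lemma twist_hom: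
  assumes "f \<in> twists"
  shows "f (x + y) = f x + f y" "f (- x) = - f x" "f (\<alpha> x) = \<alpha> (f x)" "f (\<beta> x) = \<beta> (f x)"
  using assms by (induction rule: twists.induct) (simp_all add: hom_simps commute)

lemma twist_commute: "f \<in> twists \<Longrightarrow> h \<in> twists \<Longrightarrow> f (h x) = h (f x)"
  by (induction rule: twists.induct) (simp_all add: twist_hom)

definition step :: "'g \<Rightarrow> 'g \<Rightarrow> bool" where
  "step x y \<longleftrightarrow> x \<in> \<Sigma> \<and> y \<in> \<Sigma> \<and> (\<exists>s\<in>\<Sigma>. y = \<alpha> x + \<beta> s)"

lemma stepI: "x \<in> \<Sigma> \<Longrightarrow> y \<in> \<Sigma> \<Longrightarrow> s \<in> \<Sigma> \<Longrightarrow> y = \<alpha> x + \<beta> s \<Longrightarrow> step x y"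
  by (auto simp: step_def)

text \<open>Both ends are moved by arbitrary twists, whereas a connection allows a sign only at its far end.
  The symmetric form makes the proof that this is an equivalence relation short; a sign at the near
  end can be moved to the other one by negating the whole path.\<close>

definition linked :: "'g \<Rightarrow> 'g \<Rightarrow> bool" where
  "linked a b \<longleftrightarrow> (\<exists>f\<in>twists. \<exists>h\<in>twists. step\<^sup>*\<^sup>* (f a) (h b))"

lemma step_twist: "f \<in> twists \<Longrightarrow> step x y \<Longrightarrow> step (f x) (f y)"
  unfolding step_def by (metis twist_closed twist_hom(1,3,4))

lemma path_twist: "step\<^sup>*\<^sup>* x y \<Longrightarrow> f \<in> twists \<Longrightarrow> step\<^sup>*\<^sup>* (f x) (f y)"
  by (induction rule: rtranclp_induct) (auto intro: step_twist rtranclp.rtrancl_into_rtrancl)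

text \<open>If \<open>y = \<alpha> x + \<beta> s\<close>, then adding \<open>\<beta> (- \<alpha> s)\<close> to \<open>\<alpha> y\<close> cancels the contribution of \<open>s\<close>: one returns
  to \<open>x\<close> up to \<open>\<alpha>\<^sup>2\<close>.\<close>

lemma step_reverse:
  assumes "step x y"
  shows "step y (\<alpha> (\<alpha> x))"
proof -
  obtain s where s: "s \<in> \<Sigma>" "y = \<alpha> x + \<beta> s" "x \<in> \<Sigma>" "y \<in> \<Sigma>"
    using assms by (auto simp: step_def)
  show ?thesis
  proof (rule stepI)
    show "\<alpha> (\<alpha> x) = \<alpha> y + \<beta> (- \<alpha> s)" by (simp add: s(2) hom_simps commute)
  qed (intro s alpha_closed minus_closed)+
qed

lemma path_reverse:
  assumes "step\<^sup>*\<^sup>* x y"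
  shows "\<exists>f\<in>twists. step\<^sup>*\<^sup>* y (f x)"
  using assms
proof (induction rule: rtranclp_induct)
  case base
  show ?case by (rule bexI[OF _ twists.id]) simp
next
  case (step y z)
  then obtain f where f: "f \<in> twists" "step\<^sup>*\<^sup>* y (f x)" by blast
  have "\<alpha> \<circ> (\<alpha> \<circ> id) \<in> twists" by (intro twists.intros)
  from path_twist[OF f(2) this] have "step\<^sup>*\<^sup>* z ((\<alpha> \<circ> (\<alpha> \<circ> f)) x)"
    using step_reverse[OF step.hyps(2)] by (simp add: converse_rtranclp_into_rtranclp)
  then show ?case using f(1) by (blast intro: twists.intros)
qed

lemma linked_sym:
  assumes "linked a b"
  shows "linked b a"
proof -
  obtain f h where fh: "f \<in> twists" "h \<in> twists" "step\<^sup>*\<^sup>* (f a) (h b)"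
    using assms by (auto simp: linked_def)
  obtain k where "k \<in> twists" "step\<^sup>*\<^sup>* (h b) ((k \<circ> f) a)"
    using path_reverse[OF fh(3)] by auto
  then show ?thesis
    unfolding linked_def using fh twist_comp by blast
qed

text \<open>The two paths meet after the first is moved by \<open>p\<close> and the second by \<open>h\<close>, as twists commute.\<close>

lemma linked_trans:
  assumes "linked a b" "linked b c"
  shows "linked a c"
proof -
  obtain f h where fh: "f \<in> twists" "h \<in> twists" "step\<^sup>*\<^sup>* (f a) (h b)"
    using assms by (auto simp: linked_def)
  obtain p q where pq: "p \<in> twists" "q \<in> twists" "step\<^sup>*\<^sup>* (p b) (q c)"
    using assms by (auto simp: linked_def)
  have "step\<^sup>*\<^sup>* (p (f a)) (h (p b))"
    using path_twist[OF fh(3) pq(1)] by (simp add: twist_commute fh pq)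
  also have "step\<^sup>*\<^sup>* (h (p b)) (h (q c))"
    by (rule path_twist[OF pq(3) fh(2)])
  finally have "step\<^sup>*\<^sup>* ((p \<circ> f) a) ((h \<circ> q) c)" by simp
  then show ?thesis
    unfolding linked_def using fh pq twist_comp by blast
qed

lemma linked_twist:
  assumes "f \<in> twists"
  shows "linked a (f a)"
proof -
  have "step\<^sup>*\<^sup>* (f a) (id (f a))" by simp
  then show ?thesis unfolding linked_def using assms twists.id by blast
qed

text \<open>Put \<open>c = \<alpha> (\<beta> (a + b))\<close>. If \<open>c = 0\<close>, then \<open>a\<close> and \<open>b\<close> have twists that are opposite to each other.
  Otherwise there is a path \<open>\<beta> a \<mapsto> c \<mapsto> \<alpha>\<^sup>2 (\<beta> b)\<close>: the first step adds \<open>\<beta> (\<alpha> b)\<close>, the second one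
  removes the contribution of \<open>a\<close>.\<close>

lemma linked_if_sum_in_support:
  assumes "a \<in> \<Sigma>" "b \<in> \<Sigma>" "\<alpha> (\<beta> (a + b)) \<in> insert 0 \<Sigma>"
  shows "linked a b"
proof (cases "\<alpha> (\<beta> (a + b)) = 0")
  case True
  then have "\<alpha> (\<beta> a) = - \<alpha> (\<beta> b)"
    by (simp add: hom_simps eq_neg_iff_add_eq_0)
  then have "step\<^sup>*\<^sup>* ((\<alpha> \<circ> (\<beta> \<circ> id)) a) ((uminus \<circ> (\<alpha> \<circ> (\<beta> \<circ> id))) b)" by simp
  then show ?thesis unfolding linked_def by (blast intro: twists.intros)
next
  case False
  let ?c = "\<alpha> (\<beta> (a + b))"
  have c: "?c \<in> \<Sigma>" using False assms(3) by simp
  have "step (\<beta> a) ?c"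
  proof (rule stepI)
    show "?c = \<alpha> (\<beta> a) + \<beta> (\<alpha> b)" by (simp add: hom_simps commute)
  qed (intro c assms alpha_closed beta_closed)+
  moreover have "step ?c (\<alpha> (\<alpha> (\<beta> b)))"
  proof (rule stepI)
    show "\<alpha> (\<alpha> (\<beta> b)) = \<alpha> ?c + \<beta> (- \<alpha> (\<alpha> a))" by (simp add: hom_simps commute)
  qed (intro c assms alpha_closed beta_closed minus_closed)+
  ultimately have "step\<^sup>*\<^sup>* ((\<beta> \<circ> id) a) ((\<alpha> \<circ> (\<alpha> \<circ> (\<beta> \<circ> id))) b)" by simp
  then show ?thesis unfolding linked_def by (blast intro: twists.intros)
qed

lemma alpha_funpow: "f \<in> twists \<Longrightarrow> (\<alpha> ^^ n) \<circ> f \<in> twists"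
  by (induction n) (auto simp: comp_assoc intro: twists.intros)

lemma beta_funpow: "f \<in> twists \<Longrightarrow> (\<beta> ^^ n) \<circ> f \<in> twists"
  by (induction n) (auto simp: comp_assoc intro: twists.intros)

lemma orbit_set_twist: "x \<in> orbit_set \<alpha> \<beta> a \<Longrightarrow> \<exists>f\<in>twists. x = f a"
  using alpha_funpow[OF beta_funpow[OF twists.id]] unfolding orbit_set_def comp_id by blast

lemma signed_orbit_set_eq: "signed_orbit_set \<alpha> \<beta> a = {f a | f. f \<in> twists}"
proof (intro equalityI subsetI)
  fix x assume "x \<in> signed_orbit_set \<alpha> \<beta> a"
  then obtain y where "y \<in> orbit_set \<alpha> \<beta> a" "x = y \<or> x = - y"
    by (auto simp: signed_orbit_set_def)
  then obtain f where "f \<in> twists" "x = f a \<or> x = (uminus \<circ> f) a"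
    using orbit_set_twist by force
  then show "x \<in> {f a | f. f \<in> twists}" by (blast intro: twists.minus)
next
  have beta_pow: "\<beta> ((\<alpha> ^^ i) y) = (\<alpha> ^^ i) (\<beta> y)" for i y
    by (induction i) (simp_all add: commute[symmetric])
  have orbit_alpha: "\<alpha> x \<in> orbit_set \<alpha> \<beta> a" if x: "x \<in> orbit_set \<alpha> \<beta> a" for x
  proof -
    obtain i j where "x = ((\<alpha> ^^ i) \<circ> (\<beta> ^^ j)) a" using x unfolding orbit_set_def by blast
    then have "\<alpha> x = ((\<alpha> ^^ Suc i) \<circ> (\<beta> ^^ j)) a" by simp
    then show ?thesis unfolding orbit_set_def by blast
  qed
  have orbit_beta: "\<beta> x \<in> orbit_set \<alpha> \<beta> a" if x: "x \<in> orbit_set \<alpha> \<beta> a" for x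
  proof -
    obtain i j where "x = ((\<alpha> ^^ i) \<circ> (\<beta> ^^ j)) a" using x unfolding orbit_set_def by blast
    then have "\<beta> x = ((\<alpha> ^^ i) \<circ> (\<beta> ^^ Suc j)) a" by (simp add: beta_pow)
    then show ?thesis unfolding orbit_set_def by blast
  qed
  have "f a \<in> signed_orbit_set \<alpha> \<beta> a" if "f \<in> twists" for f
    using that
  proof (induction rule: twists.induct)
    case id
    have "a = ((\<alpha> ^^ 0) \<circ> (\<beta> ^^ 0)) a" by simp
    then show ?case unfolding signed_orbit_set_def orbit_set_def id_apply by blast
  qed (auto simp: signed_orbit_set_def hom_simps orbit_alpha orbit_beta)
  then show "x \<in> signed_orbit_set \<alpha> \<beta> a" if "x \<in> {f a | f. f \<in> twists}" for x
    using that by blast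
qed

lemma conn_sum_one: "conn_sum \<alpha> \<beta> s (Suc 0) = s 1"
  by (simp add: conn_sum_def)

text \<open>This recursion is what turns the sums in the definition of a connection into the vertices of a
  path.\<close>

lemma conn_sum_Suc:
  assumes "l \<ge> 1"
  shows "conn_sum \<alpha> \<beta> s (Suc l) = \<alpha> (conn_sum \<alpha> \<beta> s l) + \<beta> (s (Suc l))"
proof -
  have shift: "(\<alpha> ^^ (Suc l - t)) x = \<alpha> ((\<alpha> ^^ (l - t)) x)" if "t \<le> l" for t x
    using that by (simp add: Suc_diff_le)
  have "(\<Sum>t = 2..Suc l. ((\<alpha> ^^ (Suc l - t)) \<circ> \<beta>) (s t))
      = (\<Sum>t = 2..l. ((\<alpha> ^^ (Suc l - t)) \<circ> \<beta>) (s t)) + \<beta> (s (Suc l))"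
    using assms by simp
  also have "(\<Sum>t = 2..l. ((\<alpha> ^^ (Suc l - t)) \<circ> \<beta>) (s t))
      = \<alpha> (\<Sum>t = 2..l. ((\<alpha> ^^ (l - t)) \<circ> \<beta>) (s t))"
    unfolding additive.sum[OF add_alpha] by (rule sum.cong) (simp_all add: shift)
  finally show ?thesis
    using shift[of 1 "s 1"] assms by (simp add: conn_sum_def hom_simps)
qed

lemma conn_sum_cong:
  assumes "\<And>t. 1 \<le> t \<Longrightarrow> t \<le> l \<Longrightarrow> s t = s' t" "l \<ge> 1"
  shows "conn_sum \<alpha> \<beta> s l = conn_sum \<alpha> \<beta> s' l"
  unfolding conn_sum_def using assms by (auto intro!: arg_cong2[where f = "(+)"] sum.cong)

lemma path_of_conn_sums:
  assumes "k \<ge> 1" "\<forall>t\<in>{1..k}. s t \<in> \<Sigma>" "\<forall>l\<in>{1..k}. conn_sum \<alpha> \<beta> s l \<in> \<Sigma>"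
  shows "step\<^sup>*\<^sup>* (s 1) (conn_sum \<alpha> \<beta> s k)"
  using assms
proof (induction k rule: dec_induct)
  case base
  then show ?case by (simp add: conn_sum_one)
next
  case (step l)
  have "step\<^sup>*\<^sup>* (s 1) (conn_sum \<alpha> \<beta> s l)" using step by simp
  moreover have "step (conn_sum \<alpha> \<beta> s l) (conn_sum \<alpha> \<beta> s (Suc l))"
    unfolding step_def
  proof (intro conjI bexI)
    show "conn_sum \<alpha> \<beta> s (Suc l) = \<alpha> (conn_sum \<alpha> \<beta> s l) + \<beta> (s (Suc l))"
      using step.hyps by (simp add: conn_sum_Suc)
  qed (use step in auto)
  ultimately show ?case by simp
qed

lemma conn_sums_of_path:
  assumes "step\<^sup>*\<^sup>* x y" "x \<in> \<Sigma>"
  shows "\<exists>k s. k \<ge> 1 \<and> (\<forall>t\<in>{1..k}. s t \<in> \<Sigma>) \<and> s 1 = x \<and>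
    (\<forall>l\<in>{1..k}. conn_sum \<alpha> \<beta> s l \<in> \<Sigma>) \<and> conn_sum \<alpha> \<beta> s k = y"
  using assms
proof (induction rule: rtranclp_induct)
  case base
  then show ?case by (intro exI[of _ 1] exI[of _ "\<lambda>_. x"]) (simp add: conn_sum_one)
next
  case (step y z)
  then obtain k s where k: "k \<ge> 1" "\<forall>t\<in>{1..k}. s t \<in> \<Sigma>" "s 1 = x"
    "\<forall>l\<in>{1..k}. conn_sum \<alpha> \<beta> s l \<in> \<Sigma>" "conn_sum \<alpha> \<beta> s k = y" by blast
  obtain e where e: "e \<in> \<Sigma>" "z = \<alpha> y + \<beta> e" "z \<in> \<Sigma>"
    using step.hyps(2) by (auto simp: step_def)
  define s' where "s' = s(Suc k := e)"
  have s': "s' (Suc k) = e" "\<And>t. t \<le> k \<Longrightarrow> s' t = s t" by (simp_all add: s'_def)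
  have same: "conn_sum \<alpha> \<beta> s' l = conn_sum \<alpha> \<beta> s l" if "l \<in> {1..k}" for l
    by (rule conn_sum_cong) (use that s' in auto)
  have last: "conn_sum \<alpha> \<beta> s' (Suc k) = z"
    using conn_sum_Suc[of k s'] same[of k] k e s' by simp
  show ?case
    by (intro exI[of _ "Suc k"] exI[of _ s'])
      (use k e same last s' in \<open>auto simp: atLeastAtMostSuc_conv\<close>)
qed

text \<open>The cases \<open>k = 1\<close> and \<open>k \<ge> 2\<close> become one, because the first sum is \<open>s 1\<close> and the last
  sum, being in the signed orbit of \<open>b\<close>, automatically belongs to \<open>\<Sigma>\<close>.\<close>

lemma is_connection_iff:
  assumes "b \<in> \<Sigma>"
  shows "is_connection \<alpha> \<beta> \<Sigma> a b k s \<longleftrightarrow>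
    k \<ge> 1 \<and> (\<forall>t\<in>{1..k}. s t \<in> \<Sigma>) \<and> s 1 \<in> orbit_set \<alpha> \<beta> a \<and>
    (\<forall>l\<in>{1..k}. conn_sum \<alpha> \<beta> s l \<in> \<Sigma>) \<and> conn_sum \<alpha> \<beta> s k \<in> signed_orbit_set \<alpha> \<beta> b"
    (is "?L \<longleftrightarrow> ?R")
proof
  assume L: ?L
  have last: "conn_sum \<alpha> \<beta> s k \<in> signed_orbit_set \<alpha> \<beta> b"
    using L by (auto simp: is_connection_def conn_sum_one split: if_splits)
  have "conn_sum \<alpha> \<beta> s k \<in> \<Sigma>"
    using last assms twist_closed by (auto simp: signed_orbit_set_eq)
  moreover have "conn_sum \<alpha> \<beta> s 1 \<in> \<Sigma>"
    using L by (auto simp: is_connection_def conn_sum_one)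
  moreover have "conn_sum \<alpha> \<beta> s l \<in> \<Sigma>" if "l \<in> {2..k-1}" for l
    using L that by (auto simp: is_connection_def split: if_splits)
  ultimately have "conn_sum \<alpha> \<beta> s l \<in> \<Sigma>" if "l \<in> {1..k}" for l
    using that by (cases "l = 1"; cases "l = k") auto
  then show ?R
    using L last by (auto simp: is_connection_def split: if_splits)
next
  assume ?R
  then show ?L by (auto simp: is_connection_def conn_sum_one)
qed

lemma conn_rel_iff_linked:
  assumes "a \<in> \<Sigma>" "b \<in> \<Sigma>"
  shows "(a, b) \<in> conn_rel \<alpha> \<beta> \<Sigma> \<longleftrightarrow> linked a b"
proof
  assume "(a, b) \<in> conn_rel \<alpha> \<beta> \<Sigma>"
  then obtain k s where "is_connection \<alpha> \<beta> \<Sigma> a b k s"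
    by (auto simp: conn_rel_def)
  then have "s 1 \<in> orbit_set \<alpha> \<beta> a" "conn_sum \<alpha> \<beta> s k \<in> signed_orbit_set \<alpha> \<beta> b"
    and path: "step\<^sup>*\<^sup>* (s 1) (conn_sum \<alpha> \<beta> s k)"
    using path_of_conn_sums[of k s] unfolding is_connection_iff[OF assms(2)] by blast+
  then obtain f h where "f \<in> twists" "s 1 = f a" "h \<in> twists" "conn_sum \<alpha> \<beta> s k = h b"
    using orbit_set_twist unfolding signed_orbit_set_eq by blast
  then show "linked a b"
    using path unfolding linked_def by metis
next
  assume "linked a b"
  then obtain f h where fh: "f \<in> twists" "h \<in> twists" "step\<^sup>*\<^sup>* (f a) (h b)"
    by (auto simp: linked_def)
  have "f a \<in> orbit_set \<alpha> \<beta> a \<or> - f a \<in> orbit_set \<alpha> \<beta> a"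
  proof -
    have "f a \<in> signed_orbit_set \<alpha> \<beta> a"
      unfolding signed_orbit_set_eq using fh(1) by blast
    then show ?thesis by (auto simp: signed_orbit_set_def)
  qed
  then obtain x y where xy: "x \<in> orbit_set \<alpha> \<beta> a" "y \<in> signed_orbit_set \<alpha> \<beta> b" "step\<^sup>*\<^sup>* x y"
  proof
    assume "f a \<in> orbit_set \<alpha> \<beta> a"
    then show ?thesis using that fh by (auto simp: signed_orbit_set_eq)
  next
    assume "- f a \<in> orbit_set \<alpha> \<beta> a"
    moreover have "step\<^sup>*\<^sup>* (- f a) ((uminus \<circ> h) b)"
      using path_twist[OF fh(3) twists.minus[OF twists.id]] by simp
    moreover have "(uminus \<circ> h) b \<in> signed_orbit_set \<alpha> \<beta> b"
      unfolding signed_orbit_set_eq using twists.minus[OF fh(2)] by blast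
    ultimately show ?thesis by (intro that)
  qed
  have "x \<in> \<Sigma>" using orbit_set_twist[OF xy(1)] assms twist_closed by blast
  from conn_sums_of_path[OF xy(3) this] obtain k s where "is_connection \<alpha> \<beta> \<Sigma> a b k s"
    using xy(1,2) unfolding is_connection_iff[OF assms(2)] by blast
  then show "(a, b) \<in> conn_rel \<alpha> \<beta> \<Sigma>"
    using assms unfolding conn_rel_def by blast
qed

lemma conn_class_iff_linked:
  "a \<in> \<Sigma> \<Longrightarrow> b \<in> conn_class \<alpha> \<beta> \<Sigma> a \<longleftrightarrow> b \<in> \<Sigma> \<and> linked a b"
  using conn_rel_iff_linked by (auto simp: conn_rel_def)

lemma conn_class_twist:
  assumes "a \<in> \<Sigma>" "x \<in> conn_class \<alpha> \<beta> \<Sigma> a" "f \<in> twists"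
  shows "f x \<in> conn_class \<alpha> \<beta> \<Sigma> a"
  using assms linked_trans linked_twist twist_closed by (metis conn_class_iff_linked)

end

section \<open>The ideals of different classes annihilate each other\<close>

text \<open>Each generator \<open>x \<star> y\<close> of the degree zero part is the matrix product of \<open>\<psi> x\<close> and \<open>\<phi> y\<close>, which
  are homogeneous with degrees in \<open>C\<close> when \<open>C\<close> is a connection class.\<close>

lemma ideal_sum_subset_span_with_products:
  assumes prod: "\<And>h x y. h \<in> C \<Longrightarrow> x \<in> M (\<beta> h) \<Longrightarrow> y \<in> M (- \<alpha> h) \<Longrightarrow>
    \<psi> x \<in> (\<Union>h\<in>C. M h) \<and> \<phi> y \<in> (\<Union>h\<in>C. M h)"
  shows "ideal_sum \<psi> \<phi> \<alpha> \<beta> M C \<subseteq> mats.span (with_products (\<Union>h\<in>C. M h))"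
    (is "_ \<subseteq> mats.span (with_products ?D)")
proof -
  let ?B = "mats.span (with_products ?D)"
  have "star_set \<psi> \<phi> (M (\<beta> h)) (M (- \<alpha> h)) \<subseteq> ?B" if "h \<in> C" for h
    unfolding star_set_def
  proof (rule mats.span_mono, rule subsetI)
    fix z assume "z \<in> {star \<psi> \<phi> x y | x y. x \<in> M (\<beta> h) \<and> y \<in> M (- \<alpha> h)}"
    then obtain x y where z: "z = star \<psi> \<phi> x y" and xy: "x \<in> M (\<beta> h)" "y \<in> M (- \<alpha> h)"
      by blast
    from prod[OF that xy] show "z \<in> with_products ?D"
      unfolding z star_def with_products_def by blast
  qed
  then have "ideal_zero \<psi> \<phi> \<alpha> \<beta> M C \<subseteq> ?B"
    unfolding ideal_zero_def by (intro mats.span_minimal mats.subspace_span UN_least)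
  moreover have "class_sum M C \<subseteq> ?B"
    unfolding class_sum_def with_products_def by (intro mats.span_mono Un_upper1)
  ultimately show ?thesis
    unfolding ideal_sum_def using mats.span_add by blast
qed

theorem lemma4p2:
  fixes I :: "'i set"
    and \<psi> \<phi> :: "('i, 'r::comm_ring_1) imat \<Rightarrow> ('i, 'r) imat"
    and \<alpha> \<beta> :: "'g::ab_group_add \<Rightarrow> 'g"
    and M :: "'g \<Rightarrow> ('i, 'r) imat set"
    and g g' :: 'g
  assumes "algebra_automorphism I \<psi>" and "algebra_automorphism I \<phi>"
    and "\<forall>A\<in>fin_mats I. \<psi> (\<phi> A) = \<phi> (\<psi> A)"
    and "group_automorphism \<alpha>" and "group_automorphism \<beta>"
    and "\<alpha> \<circ> \<beta> = \<beta> \<circ> \<alpha>"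
    and "direct_sum_decomposition I M"
    and "\<forall>h. \<psi> ` M h \<subseteq> M (\<alpha> h)"
    and "\<forall>h. \<phi> ` M h \<subseteq> M (\<beta> h)"
    and "\<forall>h h'. star_set \<psi> \<phi> (M h) (M h') \<subseteq> M (\<alpha> h + \<beta> h')"
    and "\<forall>h\<in>supp M. - h \<in> supp M"
    and "g \<in> supp M" and "g' \<in> supp M"
    and "g' \<notin> conn_class \<alpha> \<beta> (supp M) g"
  shows "star_set \<psi> \<phi>
           (ideal_sum \<psi> \<phi> \<alpha> \<beta> M (conn_class \<alpha> \<beta> (supp M) g))
           (ideal_sum \<psi> \<phi> \<alpha> \<beta> M (conn_class \<alpha> \<beta> (supp M) g')) = {0}"
proof -
  note psi = assms(1) and phi = assms(2)
  have M_sub: "mats.subspace (M h)" and M_fin: "M h \<subseteq> fin_mats I" for h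
    using assms(7) by (auto simp: direct_sum_decomposition_def)
  have psi_M: "\<psi> x \<in> M (\<alpha> h)" and phi_M: "\<phi> x \<in> M (\<beta> h)" if "x \<in> M h" for x h
    using assms(8,9) that by blast+
  have comm: "\<alpha> (\<beta> x) = \<beta> (\<alpha> x)" for x
    using assms(6) by (metis comp_apply)
  have supp_iff: "h \<in> supp M \<longleftrightarrow> h \<noteq> 0 \<and> (\<exists>x\<in>M h. x \<noteq> 0)" for h
    using mats.subspace_0[OF M_sub] by (auto simp: supp_def)
  have auto_nz: "f h \<noteq> 0" if "group_automorphism f" "h \<noteq> 0" for f and h :: 'g
  proof -
    have "f 0 = 0" "inj f"
      using that(1) by (auto simp: group_automorphism_def additive.zero bij_def)
    then show ?thesis using that(2) by (metis injD)
  qed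
  have supp_closed: "a h \<in> supp M"
    if "group_automorphism a" "algebra_automorphism I f" "\<And>x. x \<in> M h \<Longrightarrow> f x \<in> M (a h)"
      "h \<in> supp M" for a f h
  proof -
    obtain x where "x \<in> M h" "x \<noteq> 0" "h \<noteq> 0" using \<open>h \<in> supp M\<close> by (auto simp: supp_iff)
    moreover from this have "f x \<noteq> 0"
      using algebra_automorphism_nonzero[OF that(2)] M_fin by blast
    ultimately show ?thesis
      using that(1,3) auto_nz unfolding supp_iff by blast
  qed
  interpret degree_dynamics \<alpha> \<beta> "supp M"
  proof (rule degree_dynamics.intro)
    show "additive \<alpha>" "additive \<beta>"
      using assms(4,5) by (auto simp: group_automorphism_def)
    show "\<alpha> h \<in> supp M" if "h \<in> supp M" for h
      using supp_closed[OF assms(4) psi psi_M that] .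
    show "\<beta> h \<in> supp M" if "h \<in> supp M" for h
      using supp_closed[OF assms(5) phi phi_M that] .
  qed (use comm assms(11) in auto)
  let ?C = "conn_class \<alpha> \<beta> (supp M)"
  let ?D = "\<lambda>a. \<Union>h\<in>?C a. M h"
  have D_fin: "?D a \<subseteq> fin_mats I" for a
    using M_fin by blast
  have alpha_C: "\<alpha> h \<in> ?C a" and beta_C: "\<beta> h \<in> ?C a" and minus_C: "- h \<in> ?C a"
    if "a \<in> supp M" "h \<in> ?C a" for a h
    using twists.intros(2-4)[OF twists.id, THEN conn_class_twist[OF that]]
    by (simp_all only: comp_apply id_apply)
  have into_span: "ideal_sum \<psi> \<phi> \<alpha> \<beta> M (?C a) \<subseteq> mats.span (with_products (?D a))"
    if a: "a \<in> supp M" for a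
  proof (rule ideal_sum_subset_span_with_products)
    fix h x y assume h: "h \<in> ?C a" and x: "x \<in> M (\<beta> h)" and y: "y \<in> M (- \<alpha> h)"
    have "\<alpha> (\<beta> h) \<in> ?C a" "\<beta> (- \<alpha> h) \<in> ?C a"
      by (intro alpha_C beta_C minus_C a h)+
    then show "\<psi> x \<in> ?D a \<and> \<phi> y \<in> ?D a"
      using psi_M[OF x] phi_M[OF y] by blast
  qed
  have psi_span: "\<psi> x \<in> mats.span (with_products (?D a))"
    if "a \<in> supp M" "x \<in> mats.span (with_products (?D a))" for a x
    by (rule algebra_automorphism_span_with_products[OF psi D_fin _ that(2)])
      (use psi_M alpha_C[OF that(1)] in blast)
  have phi_span: "\<phi> x \<in> mats.span (with_products (?D a))"
    if "a \<in> supp M" "x \<in> mats.span (with_products (?D a))" for a x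
    by (rule algebra_automorphism_span_with_products[OF phi D_fin _ that(2)])
      (use phi_M beta_C[OF that(1)] in blast)
  have not_linked: "\<not> linked a b" if "a \<in> ?C g" "b \<in> ?C g'" for a b
    using assms(12-14) that linked_trans linked_sym by (metis conn_class_iff_linked)
  have D_zero: "mat_mult x y = 0" if xy: "x \<in> ?D g" "y \<in> ?D g'" for x y
  proof (rule ccontr)
    assume nz: "mat_mult x y \<noteq> 0"
    obtain a b where ab: "a \<in> ?C g" "x \<in> M a" "b \<in> ?C g'" "y \<in> M b" using xy by blast
    have fin: "x \<in> fin_mats I" "y \<in> fin_mats I" using ab M_fin by blast+
    \<comment> \<open>The grading is only known to respect \<open>\<star>\<close>. Under the injective map \<open>\<psi> \<circ> \<phi>\<close> the matrix
      product becomes a \<open>\<star>\<close>-product of homogeneous elements.\<close>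
    have "\<phi> x \<in> M (\<beta> a)" "\<psi> y \<in> M (\<alpha> b)" using ab phi_M psi_M by blast+
    then have "star \<psi> \<phi> (\<phi> x) (\<psi> y) \<in> star_set \<psi> \<phi> (M (\<beta> a)) (M (\<alpha> b))"
      unfolding star_set_def by (intro mats.span_base) blast
    then have "star \<psi> \<phi> (\<phi> x) (\<psi> y) \<in> M (\<alpha> (\<beta> a) + \<beta> (\<alpha> b))"
      using assms(10)[rule_format, of "\<beta> a" "\<alpha> b"] by (rule subsetD[rotated])
    then have mem: "star \<psi> \<phi> (\<phi> x) (\<psi> y) \<in> M (\<alpha> (\<beta> (a + b)))"
      by (simp add: hom_simps comm)
    have "star \<psi> \<phi> (\<phi> x) (\<psi> y) = \<psi> (\<phi> (mat_mult x y))"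
    proof -
      have "\<phi> x \<in> fin_mats I" "\<phi> y \<in> fin_mats I"
        using ab phi_M M_fin by blast+
      then have "\<psi> (\<phi> (mat_mult x y)) = mat_mult (\<psi> (\<phi> x)) (\<psi> (\<phi> y))"
        using psi phi fin by (simp add: algebra_automorphism_def)
      also have "\<psi> (\<phi> y) = \<phi> (\<psi> y)" using assms(3) fin by blast
      finally show ?thesis by (simp add: star_def)
    qed
    moreover have "\<phi> (mat_mult x y) \<noteq> 0" "\<phi> (mat_mult x y) \<in> fin_mats I"
      using algebra_automorphism_nonzero[OF phi mat_mult_fin_mats[OF fin] nz]
        phi mat_mult_fin_mats[OF fin]
      by (auto simp: algebra_automorphism_def bij_betw_def)
    ultimately have "star \<psi> \<phi> (\<phi> x) (\<psi> y) \<noteq> 0"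
      using algebra_automorphism_nonzero[OF psi] by simp
    then have "\<alpha> (\<beta> (a + b)) \<in> insert 0 (supp M)"
      using mem by (auto simp: supp_iff)
    moreover have "a \<in> supp M" "b \<in> supp M" using ab by (auto simp: conn_rel_def)
    ultimately have "linked a b" by (intro linked_if_sum_in_support)
    then show False using not_linked ab by blast
  qed
  have "star \<psi> \<phi> x y = 0"
    if "x \<in> ideal_sum \<psi> \<phi> \<alpha> \<beta> M (?C g)" "y \<in> ideal_sum \<psi> \<phi> \<alpha> \<beta> M (?C g')" for x y
    unfolding star_def
    by (rule with_products_annihilate[OF D_fin[of g] D_fin[of g'] D_zero psi_span phi_span])
      (use that into_span assms(12,13) in auto)
  then have "{star \<psi> \<phi> x y | x y. x \<in> ideal_sum \<psi> \<phi> \<alpha> \<beta> M (?C g) \<and>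
      y \<in> ideal_sum \<psi> \<phi> \<alpha> \<beta> M (?C g')} \<subseteq> {0}" by blast
  then have "star_set \<psi> \<phi> (ideal_sum \<psi> \<phi> \<alpha> \<beta> M (?C g)) (ideal_sum \<psi> \<phi> \<alpha> \<beta> M (?C g')) \<subseteq> {0}"
    unfolding star_set_def by (intro mats.span_minimal mats.subspace_single_0)
  then show ?thesis
    unfolding star_set_def using mats.span_zero by blast
qed

end
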